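(* Let $X$ and $Y$ be uniformly discrete metric spaces of bounded geometry and let $d\in\mathcal D(X,Y)$. Then $M_{[d]}\subset\mathbb B(H_X,H_Y)$ is a ternary ring of operators.
   Context: $X$ is uniformly discrete if $\inf_{x\ne x'}d_X(x,x')>0$; it has bounded geometry if for every $R>0$ there is $C>0$ such that every ball of radius $R$ has at most $C$ points. $\mathcal D(X,Y)$ is the set of metrics $d$ on $X\sqcup Y$ such that $d|_X=d_X$, $d|_Y=d_Y$ and $\inf_{x\in X,y\in Y}d(x,y)>0$. Metrics $d_1,d_2\in\mathcal D(X,Y)$ are coarsely equivalent if there is a homeomorphism $\phi$ of $[0,\infty)$ with $\phi^{-1}(d_1(x,y))\le d_2(x,y)\le\phi(d_1(x,y))$ for all $x\in X$, $y\in Y$; $[d]$ is the coarse equivalence class. $H_X=l_2(X)$, $H_Y=l_2(Y)$ with standard orthonormal bases $\delta_x$, $\delta_y$. A bounded operator $S:H_X\to H_Y$ has propagation $\le L$ with respect to $d$ if $S_{yx}=\langle\delta_y,S\delta_x\rangle\neq0$ implies $d(x,y)\le L$. $M_{[d]}$ is the norm closure in $\mathbb B(H_X,H_Y)$ of the set of operators of finite propagation; it depends only on the coarse equivalence class of $d$. A ternary ring of operators in $\mathbb B(H_1,H_2)$ is a closed linear subspace $M$ such that $MM^*M\subset M$, i.e. $mn^*r\in M$ for all $m,n,r\in M$. *)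

theory Defs
  imports "HOL-Analysis.Analysis"
begin

section \<open>The complex Hilbert space of square-summable functions\<close>

typedef 'a ell2 = "{f :: 'a \<Rightarrow> complex. (\<lambda>x. (cmod (f x))\<^sup>2) summable_on UNIV}"
  by (rule exI[of _ "\<lambda>_. 0"]) simp

setup_lifting type_definition_ell2

lemma ell2_iff_bounded:
  fixes f :: "'a \<Rightarrow> complex"
  shows "(\<lambda>x. (cmod (f x))\<^sup>2) summable_on UNIV \<longleftrightarrow>
         (\<exists>B. \<forall>F. finite F \<longrightarrow> L2_set (\<lambda>x. cmod (f x)) F \<le> B)"
proof
  assume s: "(\<lambda>x. (cmod (f x))\<^sup>2) summable_on UNIV"
  have "L2_set (\<lambda>x. cmod (f x)) F \<le> sqrt (\<Sum>\<^sub>\<infinity>x. (cmod (f x))\<^sup>2)" if "finite F" for F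
    unfolding L2_set_def
    by (intro real_sqrt_le_mono finite_sum_le_infsum[OF s that]) auto
  then show "\<exists>B. \<forall>F. finite F \<longrightarrow> L2_set (\<lambda>x. cmod (f x)) F \<le> B"
    by blast
next
  assume "\<exists>B. \<forall>F. finite F \<longrightarrow> L2_set (\<lambda>x. cmod (f x)) F \<le> B"
  then obtain B where B: "L2_set (\<lambda>x. cmod (f x)) F \<le> B" if "finite F" for F
    by blast
  have "(\<Sum>x\<in>F. (cmod (f x))\<^sup>2) \<le> B\<^sup>2" if "finite F" for F
    using B[OF that] sqrt_le_D unfolding L2_set_def by blast
  then show "(\<lambda>x. (cmod (f x))\<^sup>2) summable_on UNIV"
    by (intro nonneg_bdd_above_summable_on bdd_aboveI2[where M = "B\<^sup>2"]) auto
qed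

lemma L2_set_cmod_add_le:
  "L2_set (\<lambda>x. cmod (f x + g x)) F \<le> L2_set (\<lambda>x. cmod (f x)) F + L2_set (\<lambda>x. cmod (g x)) F"
  by (rule order_trans[OF L2_set_mono L2_set_triangle_ineq]) (auto intro: norm_triangle_ineq)

lemma L2_set_cmod_cmult:
  "L2_set (\<lambda>x. cmod (c * f x)) F = cmod c * L2_set (\<lambda>x. cmod (f x)) F"
  by (simp add: norm_mult L2_set_right_distrib)

lift_definition cscale :: "complex \<Rightarrow> 'a ell2 \<Rightarrow> 'a ell2" is "\<lambda>c f x. c * f x"
  by (simp add: norm_mult power_mult_distrib summable_on_cmult_right)

lift_definition ket :: "'a \<Rightarrow> 'a ell2" is "\<lambda>a x. if x = a then 1 else 0"
proof -
  fix a :: 'a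
  have "(\<lambda>x. (cmod (if x = a then 1 else 0))\<^sup>2) summable_on {a}"
    by simp
  then show "(\<lambda>x. (cmod (if x = a then 1 else 0))\<^sup>2) summable_on UNIV"
    by (rule summable_on_cong_neutral[THEN iffD1, rotated -1]) auto
qed

text \<open>Antilinear in the first argument.\<close>
lift_definition cinner :: "'a ell2 \<Rightarrow> 'a ell2 \<Rightarrow> complex" is
  "\<lambda>f g. \<Sum>\<^sub>\<infinity>x. cnj (f x) * g x" .

instantiation ell2 :: (type) real_normed_vector
begin

lift_definition zero_ell2 :: "'a ell2" is "\<lambda>_. 0" by simp

lift_definition plus_ell2 :: "'a ell2 \<Rightarrow> 'a ell2 \<Rightarrow> 'a ell2" is "\<lambda>f g x. f x + g x"
proof -
  fix f g :: "'a \<Rightarrow> complex"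
  assume "(\<lambda>x. (cmod (f x))\<^sup>2) summable_on UNIV" "(\<lambda>x. (cmod (g x))\<^sup>2) summable_on UNIV"
  then obtain B C where
    "\<And>F. finite F \<Longrightarrow> L2_set (\<lambda>x. cmod (f x)) F \<le> B"
    "\<And>F. finite F \<Longrightarrow> L2_set (\<lambda>x. cmod (g x)) F \<le> C"
    unfolding ell2_iff_bounded by blast
  then have "L2_set (\<lambda>x. cmod (f x + g x)) F \<le> B + C" if "finite F" for F
    using that L2_set_cmod_add_le by (metis add_mono order_trans)
  then show "(\<lambda>x. (cmod (f x + g x))\<^sup>2) summable_on UNIV"
    unfolding ell2_iff_bounded by blast
qed

lift_definition uminus_ell2 :: "'a ell2 \<Rightarrow> 'a ell2" is "\<lambda>f x. - f x" by simp

definition minus_ell2 :: "'a ell2 \<Rightarrow> 'a ell2 \<Rightarrow> 'a ell2" where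
  "f - g = f + (- g)" for f g :: "'a ell2"

definition scaleR_ell2 :: "real \<Rightarrow> 'a ell2 \<Rightarrow> 'a ell2" where
  "scaleR_ell2 r = cscale (complex_of_real r)"

lift_definition norm_ell2 :: "'a ell2 \<Rightarrow> real" is
  "\<lambda>f. sqrt (\<Sum>\<^sub>\<infinity>x. (cmod (f x))\<^sup>2)" .

definition sgn_ell2 :: "'a ell2 \<Rightarrow> 'a ell2" where
  "sgn_ell2 f = scaleR (inverse (norm f)) f"

definition dist_ell2 :: "'a ell2 \<Rightarrow> 'a ell2 \<Rightarrow> real" where
  "dist_ell2 f g = norm (f - g)"

definition uniformity_ell2 :: "('a ell2 \<times> 'a ell2) filter" where
  "uniformity_ell2 = (INF e\<in>{0 <..}. principal {(f, g). dist f g < e})"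

definition open_ell2 :: "'a ell2 set \<Rightarrow> bool" where
  "open_ell2 U = (\<forall>f\<in>U. \<forall>\<^sub>F (f', g) in uniformity. f' = f \<longrightarrow> g \<in> U)"

instance
proof
  fix f g h :: "'a ell2" and r s :: real and U :: "'a ell2 set"
  show "f + g + h = f + (g + h)" by transfer (simp add: add.assoc)
  show "f + g = g + f" by transfer (simp add: add.commute)
  show "0 + f = f" by transfer simp
  show "- f + f = 0" by transfer simp
  show "f - g = f + - g" by (rule minus_ell2_def)
  show "r *\<^sub>R (f + g) = r *\<^sub>R f + r *\<^sub>R g"
    unfolding scaleR_ell2_def by transfer (simp add: distrib_left)
  show "(r + s) *\<^sub>R f = r *\<^sub>R f + s *\<^sub>R f"
    unfolding scaleR_ell2_def by transfer (simp add: distrib_right)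
  show "r *\<^sub>R s *\<^sub>R f = (r * s) *\<^sub>R f"
    unfolding scaleR_ell2_def by transfer (simp add: mult.assoc)
  show "1 *\<^sub>R f = f"
    unfolding scaleR_ell2_def by transfer simp
  show "sgn f = scaleR (inverse (norm f)) f" by (rule sgn_ell2_def)
  show "dist f g = norm (f - g)" by (rule dist_ell2_def)
  show "uniformity = (INF e\<in>{0 <..}. principal {(f :: 'a ell2, g). dist f g < e})"
    by (rule uniformity_ell2_def)
  show "open U = (\<forall>f\<in>U. \<forall>\<^sub>F (f', g) in uniformity. f' = f \<longrightarrow> g \<in> U)"
    by (rule open_ell2_def)
  show "norm f = 0 \<longleftrightarrow> f = 0"
  proof transfer
    fix f :: "'a \<Rightarrow> complex"
    assume s: "(\<lambda>x. (cmod (f x))\<^sup>2) summable_on UNIV"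
    have z: "f = (\<lambda>_. 0)" if "sqrt (\<Sum>\<^sub>\<infinity>x. (cmod (f x))\<^sup>2) = 0"
    proof
      fix x
      have "(cmod (f x))\<^sup>2 = 0"
        by (rule nonneg_infsum_le_0D[OF _ s]) (use that in simp_all)
      then show "f x = 0" by simp
    qed
    show "sqrt (\<Sum>\<^sub>\<infinity>x. (cmod (f x))\<^sup>2) = 0 \<longleftrightarrow> f = (\<lambda>_. 0)"
    proof
      assume "f = (\<lambda>_. 0)"
      then show "sqrt (\<Sum>\<^sub>\<infinity>x. (cmod (f x))\<^sup>2) = 0" by simp
    qed (rule z)
  qed
  show "norm (f + g) \<le> norm f + norm g"
  proof transfer
    fix f g :: "'a \<Rightarrow> complex"
    assume s: "(\<lambda>x. (cmod (f x))\<^sup>2) summable_on UNIV" "(\<lambda>x. (cmod (g x))\<^sup>2) summable_on UNIV"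
    define N where "N = (\<lambda>h :: 'a \<Rightarrow> complex. sqrt (\<Sum>\<^sub>\<infinity>x. (cmod (h x))\<^sup>2))"
    have le: "L2_set (\<lambda>x. cmod (h x)) F \<le> N h"
      if "(\<lambda>x. (cmod (h x))\<^sup>2) summable_on UNIV" "finite F" for h F
      unfolding L2_set_def N_def
      by (intro real_sqrt_le_mono finite_sum_le_infsum[OF that]) auto
    have nn: "0 \<le> N h" for h
      unfolding N_def by (simp add: infsum_nonneg)
    have fin: "L2_set (\<lambda>x. cmod (f x + g x)) F \<le> N f + N g" if "finite F" for F
      using L2_set_cmod_add_le[of f g F] le[OF s(1) that] le[OF s(2) that] by linarith
    then have s': "(\<lambda>x. (cmod (f x + g x))\<^sup>2) summable_on UNIV"
      unfolding ell2_iff_bounded by blast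
    have "(\<Sum>\<^sub>\<infinity>x. (cmod (f x + g x))\<^sup>2) \<le> (N f + N g)\<^sup>2"
      by (rule infsum_le_finite_sums[OF s'])
        (rule sqrt_le_D, use fin in \<open>simp add: L2_set_def\<close>)
    then have "sqrt (\<Sum>\<^sub>\<infinity>x. (cmod (f x + g x))\<^sup>2) \<le> N f + N g"
      using nn[of f] nn[of g] by (intro real_le_lsqrt) auto
    then show "sqrt (\<Sum>\<^sub>\<infinity>x. (cmod (f x + g x))\<^sup>2)
        \<le> sqrt (\<Sum>\<^sub>\<infinity>x. (cmod (f x))\<^sup>2) + sqrt (\<Sum>\<^sub>\<infinity>x. (cmod (g x))\<^sup>2)"
      unfolding N_def .
  qed
  show "norm (r *\<^sub>R f) = \<bar>r\<bar> * norm f"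
    unfolding scaleR_ell2_def
    by transfer
      (simp add: norm_mult power_mult_distrib infsum_cmult_right' real_sqrt_mult)
qed

end

lemma cscale_add: "cscale c (f + g) = cscale c f + cscale c g"
  by transfer (simp add: distrib_left)

lemma cscale_scaleR: "cscale c (r *\<^sub>R f) = r *\<^sub>R cscale c f"
  unfolding scaleR_ell2_def by transfer (simp add: mult.left_commute)

lemma norm_cscale: "norm (cscale c f) = cmod c * norm f"
  by transfer (simp add: norm_mult power_mult_distrib infsum_cmult_right' real_sqrt_mult)


section \<open>Bounded operators\<close>

text \<open>
  The type \<^typ>\<open>'a ell2 \<Rightarrow>\<^sub>L 'b ell2\<close> consists of the bounded \<^emph>\<open>real\<close>-linear maps, with the
  operator norm; \<open>\<bool>(H\<^sub>1, H\<^sub>2)\<close> is its subset of complex-linear maps.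
\<close>
definition bounded_operators :: "('a ell2 \<Rightarrow>\<^sub>L 'b ell2) set" where
  "bounded_operators = {S. \<forall>c v. blinfun_apply S (cscale c v) = cscale c (blinfun_apply S v)}"

definition op_cscale :: "complex \<Rightarrow> ('a ell2 \<Rightarrow>\<^sub>L 'b ell2) \<Rightarrow> ('a ell2 \<Rightarrow>\<^sub>L 'b ell2)" where
  "op_cscale c S = Blinfun (\<lambda>v. cscale c (blinfun_apply S v))"

lemma blinfun_apply_op_cscale:
  fixes S :: "'a ell2 \<Rightarrow>\<^sub>L 'b ell2"
  shows "blinfun_apply (op_cscale c S) v = cscale c (blinfun_apply S v)"
proof -
  have "bounded_linear (cscale c :: 'b ell2 \<Rightarrow> 'b ell2)"
    by (rule bounded_linear_intro[where K = "cmod c"])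
      (simp_all add: cscale_add cscale_scaleR norm_cscale)
  then have "bounded_linear (\<lambda>v. cscale c (blinfun_apply S v))"
    by (rule bounded_linear_compose[OF _ blinfun.bounded_linear_right])
  then show ?thesis
    unfolding op_cscale_def by (simp add: bounded_linear_Blinfun_apply)
qed

definition adj :: "('a ell2 \<Rightarrow>\<^sub>L 'b ell2) \<Rightarrow> ('b ell2 \<Rightarrow>\<^sub>L 'a ell2)" where
  "adj S = (THE T. \<forall>v w. cinner (blinfun_apply T w) v = cinner w (blinfun_apply S v))"

definition closed_complex_subspace :: "('a ell2 \<Rightarrow>\<^sub>L 'b ell2) set \<Rightarrow> bool" where
  "closed_complex_subspace M \<longleftrightarrow> closed M \<and> 0 \<in> M \<and>
     (\<forall>S\<in>M. \<forall>T\<in>M. S + T \<in> M) \<and> (\<forall>c. \<forall>S\<in>M. op_cscale c S \<in> M)"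

definition ternary_ring_of_operators :: "('a ell2 \<Rightarrow>\<^sub>L 'b ell2) set \<Rightarrow> bool" where
  "ternary_ring_of_operators M \<longleftrightarrow>
     M \<subseteq> bounded_operators \<and> closed_complex_subspace M \<and>
     (\<forall>m\<in>M. \<forall>n\<in>M. \<forall>r\<in>M. m o\<^sub>L adj n o\<^sub>L r \<in> M)"


section \<open>Coarse geometry\<close>

definition bounded_geometry :: "'a::metric_space set \<Rightarrow> bool" where
  "bounded_geometry X \<longleftrightarrow>
     (\<forall>R>0. \<exists>C::nat. C > 0 \<and> (\<forall>x\<in>X. finite (cball x R \<inter> X) \<and> card (cball x R \<inter> X) \<le> C))"

text \<open>\<open>\<D>(X, Y)\<close>, where \<open>X\<close> and \<open>Y\<close> are the types \<^typ>\<open>'x\<close> and \<^typ>\<open>'y\<close> with their own metrics.\<close>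
definition compatible_metrics ::
    "('x::metric_space + 'y::metric_space \<Rightarrow> 'x + 'y \<Rightarrow> real) set" where
  "compatible_metrics = {d. Metric_space UNIV d \<and>
     (\<forall>x x'. d (Inl x) (Inl x') = dist x x') \<and>
     (\<forall>y y'. d (Inr y) (Inr y') = dist y y') \<and>
     (INF (x, y). d (Inl x) (Inr y)) > 0}"

definition coarsely_equivalent ::
    "('x + 'y \<Rightarrow> 'x + 'y \<Rightarrow> real) \<Rightarrow> ('x + 'y \<Rightarrow> 'x + 'y \<Rightarrow> real) \<Rightarrow> bool" where
  "coarsely_equivalent d\<^sub>1 d\<^sub>2 \<longleftrightarrow>
     (\<exists>\<phi> \<psi>. homeomorphism {0..} {0..} \<phi> \<psi> \<and>
        (\<forall>x y. \<psi> (d\<^sub>1 (Inl x) (Inr y)) \<le> d\<^sub>2 (Inl x) (Inr y) \<and>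
               d\<^sub>2 (Inl x) (Inr y) \<le> \<phi> (d\<^sub>1 (Inl x) (Inr y))))"

definition propagation_le ::
    "('x + 'y \<Rightarrow> 'x + 'y \<Rightarrow> real) \<Rightarrow> ('x ell2 \<Rightarrow>\<^sub>L 'y ell2) \<Rightarrow> real \<Rightarrow> bool" where
  "propagation_le d S L \<longleftrightarrow>
     (\<forall>x y. cinner (ket y) (blinfun_apply S (ket x)) \<noteq> 0 \<longrightarrow> d (Inl x) (Inr y) \<le> L)"

definition finite_propagation_operators ::
    "('x + 'y \<Rightarrow> 'x + 'y \<Rightarrow> real) \<Rightarrow> ('x ell2 \<Rightarrow>\<^sub>L 'y ell2) set" where
  "finite_propagation_operators d = {S \<in> bounded_operators. \<exists>L. propagation_le d S L}"

text \<open>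
  \<open>M\<^bsub>[d]\<^esub>\<close>, as a function of a representative \<open>d\<close>; \<open>roe_module_cong\<close> below shows that only the
  coarse equivalence class of \<open>d\<close> matters.  The closure in \<open>\<bool>(H\<^sub>X, H\<^sub>Y)\<close> is the closure in
  the whole type, because \<^const>\<open>bounded_operators\<close> is norm closed.
\<close>
definition roe_module :: "('x + 'y \<Rightarrow> 'x + 'y \<Rightarrow> real) \<Rightarrow> ('x ell2 \<Rightarrow>\<^sub>L 'y ell2) set" where
  "roe_module d = closure (finite_propagation_operators d)"

lemma roe_module_cong:
  assumes d: "d\<^sub>1 \<in> compatible_metrics" "d\<^sub>2 \<in> compatible_metrics"
    and "coarsely_equivalent d\<^sub>1 d\<^sub>2"
  shows "roe_module d\<^sub>1 = roe_module d\<^sub>2"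
proof -
  obtain \<phi> \<psi> :: "real \<Rightarrow> real" where hom: "homeomorphism {0..} {0..} \<phi> \<psi>"
    and lower: "\<And>x y. \<psi> (d\<^sub>1 (Inl x) (Inr y)) \<le> d\<^sub>2 (Inl x) (Inr y)"
    and upper: "\<And>x y. d\<^sub>2 (Inl x) (Inr y) \<le> \<phi> (d\<^sub>1 (Inl x) (Inr y))"
    using assms(3) unfolding coarsely_equivalent_def by blast
  have nn: "0 \<le> d\<^sub>1 p q" "0 \<le> d\<^sub>2 p q" for p q
    using d unfolding compatible_metrics_def by (auto intro: Metric_space.nonneg)
  have bound: "\<exists>L'. \<forall>t. 0 \<le> t \<longrightarrow> t \<le> L \<longrightarrow> \<phi> t \<le> L'" for L
  proof -
    have "continuous_on {0..L} \<phi>"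
      by (rule continuous_on_subset[OF homeomorphism_cont1[OF hom]]) auto
    then have "compact (\<phi> ` {0..L})"
      by (rule compact_continuous_image) simp
    then have "bdd_above (\<phi> ` {0..L})"
      by (simp add: bounded_imp_bdd_above compact_imp_bounded)
    then show ?thesis
      unfolding bdd_above_def by (metis atLeastAtMost_iff imageI)
  qed
  have "\<exists>L'. propagation_le d\<^sub>2 S L'" if S: "propagation_le d\<^sub>1 S L" for S L
  proof -
    obtain L' where L': "\<And>t. 0 \<le> t \<Longrightarrow> t \<le> L \<Longrightarrow> \<phi> t \<le> L'"
      using bound[of L] by blast
    have "d\<^sub>2 (Inl x) (Inr y) \<le> L'" if "d\<^sub>1 (Inl x) (Inr y) \<le> L" for x y
      by (rule order_trans[OF upper L'[OF nn(1) that]])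
    then show ?thesis using S unfolding propagation_le_def by blast
  qed
  moreover have "\<exists>L'. propagation_le d\<^sub>1 S L'" if S: "propagation_le d\<^sub>2 S L" for S L
  proof -
    obtain L' where L': "\<And>t. 0 \<le> t \<Longrightarrow> t \<le> L \<Longrightarrow> \<phi> t \<le> L'"
      using bound[of L] by blast
    have "d\<^sub>1 (Inl x) (Inr y) \<le> L'" if "d\<^sub>2 (Inl x) (Inr y) \<le> L" for x y
    proof -
      have "\<psi> (d\<^sub>1 (Inl x) (Inr y)) \<in> {0..}"
        using homeomorphism_image2[OF hom] nn(1) by auto
      moreover have "\<psi> (d\<^sub>1 (Inl x) (Inr y)) \<le> L"
        by (rule order_trans[OF lower that])
      moreover have "\<phi> (\<psi> (d\<^sub>1 (Inl x) (Inr y))) = d\<^sub>1 (Inl x) (Inr y)"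
        using homeomorphism_apply2[OF hom] nn(1) by auto
      ultimately show ?thesis using L'[of "\<psi> (d\<^sub>1 (Inl x) (Inr y))"] by simp
    qed
    then show ?thesis using S unfolding propagation_le_def by blast
  qed
  ultimately have "finite_propagation_operators d\<^sub>1 = finite_propagation_operators d\<^sub>2"
    unfolding finite_propagation_operators_def by blast
  then show ?thesis unfolding roe_module_def by simp
qed

end

theory Submission
  imports Defs
begin

text \<open>
  If \<open>S = m n\<^sup>* r\<close> with \<open>m\<close>, \<open>n\<close>, \<open>r\<close> of finite propagation and \<open>S\<^bsub>yx\<^esub> \<noteq> 0\<close>, then some term
  \<open>m\<^bsub>yx'\<^esub> \<cdot> cnj (n\<^bsub>y'x'\<^esub>) \<cdot> r\<^bsub>y'x\<^esub>\<close> is nonzero, and the triangle inequality along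
  \<open>x, y', x', y\<close> shows that the propagations add up.  The passage to the closure uses that taking
  adjoints is a contraction.
\<close>

section \<open>The inner product\<close>

lemma summable_Rep_ell2: "(\<lambda>x. (cmod (Rep_ell2 f x))\<^sup>2) summable_on UNIV"
  using Rep_ell2 by auto

lemma power2_norm_ell2: "(norm f)\<^sup>2 = (\<Sum>\<^sub>\<infinity>x. (cmod (Rep_ell2 f x))\<^sup>2)"
  unfolding norm_ell2.rep_eq by (simp add: infsum_nonneg)

lemma L2_set_Rep_ell2_le_norm:
  assumes "finite F"
  shows "L2_set (\<lambda>x. cmod (Rep_ell2 f x)) F \<le> norm f"
  unfolding L2_set_def norm_ell2.rep_eq
  by (intro real_sqrt_le_mono finite_sum_le_infsum summable_Rep_ell2 assms) auto

text \<open>Cauchy-Schwarz over a finite set. As the bound does not depend on \<open>F\<close>, it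
  yields both the absolute convergence of the series behind \<open>cinner\<close> and, in the limit,
  Cauchy-Schwarz itself.\<close>

lemma sum_cinner_le:
  assumes "finite F"
  shows "(\<Sum>x\<in>F. cmod (cnj (Rep_ell2 f x) * Rep_ell2 g x)) \<le> norm f * norm g"
proof -
  have "(\<Sum>x\<in>F. cmod (cnj (Rep_ell2 f x) * Rep_ell2 g x))
      \<le> L2_set (\<lambda>x. cmod (Rep_ell2 f x)) F * L2_set (\<lambda>x. cmod (Rep_ell2 g x)) F"
    using L2_set_mult_ineq[of "\<lambda>x. cmod (Rep_ell2 f x)" "\<lambda>x. cmod (Rep_ell2 g x)" F]
    by (simp add: norm_mult)
  also have "\<dots> \<le> norm f * norm g"
    by (intro mult_mono L2_set_Rep_ell2_le_norm assms) auto
  finally show ?thesis .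
qed

lemma abs_summable_cinner:
  "(\<lambda>x. norm (cnj (Rep_ell2 f x) * Rep_ell2 g x)) summable_on UNIV"
  by (intro nonneg_bdd_above_summable_on bdd_aboveI2[where M = "norm f * norm g"])
    (use sum_cinner_le in auto)

lemma summable_cinner: "(\<lambda>x. cnj (Rep_ell2 f x) * Rep_ell2 g x) summable_on UNIV"
  by (rule abs_summable_summable[OF abs_summable_cinner])

lemma norm_cinner_le: "cmod (cinner f g) \<le> norm f * norm g"
proof -
  have "cmod (cinner f g) \<le> (\<Sum>\<^sub>\<infinity>x. norm (cnj (Rep_ell2 f x) * Rep_ell2 g x))"
    unfolding cinner.rep_eq by (rule norm_infsum_bound[OF abs_summable_cinner])
  also have "\<dots> \<le> norm f * norm g"
    by (rule infsum_le_finite_sums[OF abs_summable_cinner sum_cinner_le])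
  finally show ?thesis .
qed

lemma cnj_cinner: "cnj (cinner f g) = cinner g f"
  unfolding cinner.rep_eq infsum_cnj[symmetric] by (simp add: mult.commute)

lemma cinner_add_right: "cinner f (g + h) = cinner f g + cinner f h"
  unfolding cinner.rep_eq plus_ell2.rep_eq distrib_left
  by (rule infsum_add) (rule summable_cinner)+

lemma cinner_cscale_right: "cinner f (cscale c g) = c * cinner f g"
  unfolding cinner.rep_eq cscale.rep_eq
  by (simp add: mult.left_commute infsum_cmult_right')

lemma cinner_add_left: "cinner (f + g) h = cinner f h + cinner g h"
  by (metis cinner_add_right cnj_cinner complex_cnj_add)

lemma cinner_cscale_left: "cinner (cscale c f) g = cnj c * cinner f g"
  by (metis cinner_cscale_right cnj_cinner complex_cnj_mult)

text \<open>Cauchy-Schwarz gives the constant 1. The interpretation supplies continuity of the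
  pairing and its rules for sums, differences and zero; complex scalars are handled by the two
  \<open>cscale\<close> rules above.\<close>

interpretation cinner: bounded_bilinear "cinner :: 'a ell2 \<Rightarrow> 'a ell2 \<Rightarrow> complex"
proof
  fix f g :: "'a ell2" and r :: real
  show "cinner (r *\<^sub>R f) g = r *\<^sub>R cinner f g" "cinner f (r *\<^sub>R g) = r *\<^sub>R cinner f g"
    by (simp_all add: scaleR_ell2_def cinner_cscale_left cinner_cscale_right scaleR_conv_of_real)
  show "\<exists>K. \<forall>(f :: 'a ell2) g. norm (cinner f g) \<le> norm f * norm g * K"
    by (intro exI[of _ 1]) (simp add: norm_cinner_le)
qed (simp_all add: cinner_add_left cinner_add_right)

section \<open>Coordinates and finite combinations of basis vectors\<close>

lemma cinner_ket_left: "cinner (ket a) f = Rep_ell2 f a"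
proof -
  have "cinner (ket a) f = (\<Sum>\<^sub>\<infinity>x\<in>{a}. cnj (Rep_ell2 (ket a) x) * Rep_ell2 f x)"
    unfolding cinner.rep_eq by (rule infsum_cong_neutral) (auto simp: ket.rep_eq)
  then show ?thesis by (simp add: ket.rep_eq)
qed

lemma cinner_ket_right: "cinner f (ket a) = cnj (Rep_ell2 f a)"
  by (metis cinner_ket_left cnj_cinner)

text \<open>A series whose terms all vanish is zero. This extracts an intermediate point from a
  nonzero entry of a product without expanding the product as a matrix series.\<close>

lemma cinner_nonzeroE:
  assumes "cinner f g \<noteq> 0"
  obtains x where "Rep_ell2 f x \<noteq> 0" "Rep_ell2 g x \<noteq> 0"
proof (rule ccontr)
  assume "\<not> thesis"
  then have "cnj (Rep_ell2 f x) * Rep_ell2 g x = 0" for x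
    using that by fastforce
  then show False
    using assms unfolding cinner.rep_eq by (simp only: infsum_0_simp)
qed

lemma ell2_eqI:
  assumes "\<And>v. cinner f v = cinner g v"
  shows "f = g"
proof -
  have "Rep_ell2 f x = Rep_ell2 g x" for x
    using assms[of "ket x"] by (simp add: cinner_ket_right)
  then show ?thesis by (simp add: Rep_ell2_inject[symmetric] ext)
qed

lemma Rep_ell2_sum: "Rep_ell2 (\<Sum>i\<in>I. f i) x = (\<Sum>i\<in>I. Rep_ell2 (f i) x)"
  by (induction I rule: infinite_finite_induct) (simp_all add: zero_ell2.rep_eq plus_ell2.rep_eq)

lemma Rep_ell2_sum_ket:
  assumes "finite F"
  shows "Rep_ell2 (\<Sum>a\<in>F. cscale (c a) (ket a)) x = (if x \<in> F then c x else 0)"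
  using assms by (simp add: Rep_ell2_sum cscale.rep_eq ket.rep_eq if_distrib cong: if_cong)

lemma norm_sum_ket:
  assumes "finite F"
  shows "norm (\<Sum>a\<in>F. cscale (c a) (ket a)) = L2_set (\<lambda>a. cmod (c a)) F"
proof -
  have "(\<Sum>\<^sub>\<infinity>x. (cmod (if x \<in> F then c x else 0))\<^sup>2) = (\<Sum>\<^sub>\<infinity>x\<in>F. (cmod (c x))\<^sup>2)"
    by (rule infsum_cong_neutral) auto
  then show ?thesis
    using assms by (simp add: norm_ell2.rep_eq Rep_ell2_sum_ket L2_set_def)
qed

text \<open>Truncating \<open>f\<close> to \<open>F\<close> leaves an error whose squared norm is
  the tail of a convergent series.\<close>

lemma finite_ket_approximation:
  assumes "e > 0"
  obtains F where "finite F" "dist (\<Sum>a\<in>F. cscale (Rep_ell2 f a) (ket a)) f < e"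
proof -
  let ?q = "\<lambda>x. (cmod (Rep_ell2 f x))\<^sup>2"
  \<comment> \<open>The finite approximation of the series comes with a non-strict bound; the factor
    1/2 makes the final estimate strict.\<close>
  have "e\<^sup>2 / 2 > 0" using assms by simp
  then obtain F where F: "finite F" "dist (sum ?q F) (infsum ?q UNIV) \<le> e\<^sup>2 / 2"
    using infsum_finite_approximation[OF summable_Rep_ell2[of f], of "e\<^sup>2 / 2"] by auto
  let ?s = "\<Sum>a\<in>F. cscale (Rep_ell2 f a) (ket a)"
  have Rep: "Rep_ell2 (?s - f) x = (if x \<in> F then 0 else - Rep_ell2 f x)" for x
    unfolding minus_ell2_def plus_ell2.rep_eq uminus_ell2.rep_eq Rep_ell2_sum_ket[OF F(1)] by simp
  have "(norm (?s - f))\<^sup>2 = (\<Sum>\<^sub>\<infinity>x. (cmod (Rep_ell2 (?s - f) x))\<^sup>2)"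
    by (rule power2_norm_ell2)
  also have "\<dots> = infsum ?q (UNIV - F)"
    unfolding Rep by (rule infsum_cong_neutral) auto
  also have "\<dots> = infsum ?q UNIV - sum ?q F"
    using F(1) by (subst infsum_Diff[OF summable_Rep_ell2]) auto
  also have "\<dots> \<le> e\<^sup>2 / 2"
    using F(2) unfolding dist_real_def by linarith
  also have "\<dots> < e\<^sup>2"
    using assms by simp
  finally have "norm (?s - f) < e"
    by (rule power_less_imp_less_base) (use assms in simp)
  then show thesis
    using that F(1) by (simp add: dist_norm)
qed

text \<open>Finite combinations of basis vectors are dense, so a closed additive property need only
  be checked on multiples of basis vectors. It serves to verify the defining identity of the
  adjoint.\<close>

lemma ell2_closed_induct [case_names closed zero add ket]:
  fixes f :: "'a ell2"
  assumes "closed {f. P f}" and "P 0" and add: "\<And>f g. P f \<Longrightarrow> P g \<Longrightarrow> P (f + g)"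
    and ket: "\<And>c a. P (cscale c (ket a))"
  shows "P f"
proof -
  \<comment> \<open>For infinite \<open>F\<close> the sum is 0 by convention, which the case
    \<open>P 0\<close> covers.\<close>
  have P: "P (\<Sum>a\<in>F. cscale (Rep_ell2 f a) (ket a))" for F
    by (induction F rule: infinite_finite_induct) (use assms in auto)
  have "f \<in> closure {f. P f}"
    unfolding closure_approachable using P finite_ket_approximation by (metis mem_Collect_eq)
  then show ?thesis
    using assms(1) by simp
qed


section \<open>Adjoints\<close>

lemma bounded_operatorsD:
  "S \<in> bounded_operators \<Longrightarrow> blinfun_apply S (cscale c v) = cscale c (blinfun_apply S v)"
  unfolding bounded_operators_def by simp

lemma bounded_operators_diff:
  assumes "S \<in> bounded_operators" "T \<in> bounded_operators"
  shows "S - T \<in> bounded_operators"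
proof -
  have "cscale c (f - g) = cscale c f - cscale c g" for c and f g :: "'b ell2"
    by (metis add_diff_cancel cscale_add diff_add_cancel)
  then show ?thesis
    using assms unfolding bounded_operators_def by (simp add: blinfun.diff_left)
qed

lemma bounded_operators_add:
  "S \<in> bounded_operators \<Longrightarrow> T \<in> bounded_operators \<Longrightarrow> S + T \<in> bounded_operators"
  unfolding bounded_operators_def by (simp add: blinfun.add_left cscale_add)

lemma bounded_operators_compose:
  "S \<in> bounded_operators \<Longrightarrow> T \<in> bounded_operators \<Longrightarrow> S o\<^sub>L T \<in> bounded_operators"
  unfolding bounded_operators_def by simp

lemma cscale_left_commute: "cscale a (cscale b f) = cscale b (cscale a f)"
  by transfer (simp add: mult.left_commute)

lemma bounded_operators_op_cscale:
  "S \<in> bounded_operators \<Longrightarrow> op_cscale c S \<in> bounded_operators"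
  unfolding bounded_operators_def by (simp add: blinfun_apply_op_cscale cscale_left_commute)

lemma bounded_linear_cscale: "bounded_linear (cscale c)"
  by (rule bounded_linear_intro[where K = "cmod c"])
    (simp_all add: cscale_add cscale_scaleR norm_cscale)

lemma bounded_linear_op_cscale: "bounded_linear (op_cscale c)"
proof (rule bounded_linear_intro[where K = "cmod c"])
  fix S T :: "'a ell2 \<Rightarrow>\<^sub>L 'b ell2" and r :: real
  show "op_cscale c (S + T) = op_cscale c S + op_cscale c T"
    by (rule blinfun_eqI) (simp add: blinfun_apply_op_cscale blinfun.add_left cscale_add)
  show "op_cscale c (r *\<^sub>R S) = r *\<^sub>R op_cscale c S"
    by (rule blinfun_eqI) (simp add: blinfun_apply_op_cscale blinfun.scaleR_left cscale_scaleR)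
  show "norm (op_cscale c S) \<le> norm S * cmod c"
    by (rule norm_blinfun_bound)
      (simp_all add: blinfun_apply_op_cscale norm_cscale norm_blinfun mult.assoc
        mult.left_commute[of _ "cmod c"] mult_left_mono)
qed

text \<open>For fixed \<open>c\<close> and \<open>v\<close>, both sides of the linearity equation
  depend continuously on \<open>S\<close>, so the set is an intersection of closed sets. Hence norm
  limits of complex-linear operators still have adjoints.\<close>

lemma closed_bounded_operators: "closed (bounded_operators :: ('a ell2 \<Rightarrow>\<^sub>L 'b ell2) set)"
proof -
  have "closed {S :: 'a ell2 \<Rightarrow>\<^sub>L 'b ell2.
      blinfun_apply S (cscale c v) = cscale c (blinfun_apply S v)}" for c v
    by (intro closed_Collect_eq continuous_intros
        bounded_linear.continuous_on[OF bounded_linear_cscale])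
  then show ?thesis
    unfolding bounded_operators_def by (intro closed_Collect_all)
qed

text \<open>The numbers bounded here are the future coordinates of the adjoint applied to
  \<open>w\<close>. Testing \<open>S\<close> on the vector \<open>v\<close> that has these
  coordinates on \<open>F\<close> gives \<open>N * N\<close> \<le>
  \<open>(norm S * norm w) * N\<close>, and \<open>N\<close> cancels unless it is 0.\<close>

lemma adjoint_coordinates_bound:
  fixes S :: "'a ell2 \<Rightarrow>\<^sub>L 'b ell2"
  assumes S: "S \<in> bounded_operators" and F: "finite F"
  shows "L2_set (\<lambda>x. cmod (cinner (blinfun_apply S (ket x)) w)) F \<le> norm S * norm w"
proof -
  let ?c = "\<lambda>x. cinner (blinfun_apply S (ket x)) w"
  define N where "N = L2_set (\<lambda>x. cmod (?c x)) F"
  define v where "v = (\<Sum>x\<in>F. cscale (?c x) (ket x))"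
  have N: "norm v = N"
    unfolding v_def N_def by (rule norm_sum_ket[OF F])
  \<comment> \<open>Antilinearity in the first argument conjugates the coefficients of
    \<open>v\<close>, so every term becomes a squared modulus.\<close>
  have "cinner (blinfun_apply S v) w = (\<Sum>x\<in>F. cnj (?c x) * ?c x)"
    unfolding v_def
    by (simp add: blinfun.sum_right cinner.sum_left bounded_operatorsD[OF S] cinner_cscale_left)
  also have "\<dots> = complex_of_real (N\<^sup>2)"
    unfolding N_def L2_set_def
    by (simp add: sum_nonneg complex_norm_square mult.commute del: of_real_power)
  finally have "N\<^sup>2 = cmod (cinner (blinfun_apply S v) w)"
    by (metis norm_of_real abs_of_nonneg zero_le_power2)
  also have "\<dots> \<le> norm (blinfun_apply S v) * norm w"
    by (rule norm_cinner_le)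
  also have "\<dots> \<le> norm S * norm v * norm w"
    by (intro mult_right_mono norm_blinfun) simp
  finally have "N * N \<le> (norm S * norm w) * N"
    by (simp add: N power2_eq_square mult_ac)
  moreover have "N \<ge> 0"
    unfolding N_def by simp
  ultimately have "N \<le> norm S * norm w"
    by (cases "N = 0") (auto simp: mult_le_cancel_right)
  then show ?thesis
    unfolding N_def .
qed

text \<open>The adjoint is built from its coordinates: the uniform bound on finite sets makes them
  square-summable, and the same bound controls the norm.\<close>

lemma adjoint_exists:
  fixes S :: "'a ell2 \<Rightarrow>\<^sub>L 'b ell2"
  assumes S: "S \<in> bounded_operators"
  obtains T where "norm T \<le> norm S"
    "\<And>v w. cinner (blinfun_apply T w) v = cinner w (blinfun_apply S v)"
proof -
  \<comment> \<open>This choice is forced: pairing the adjoint image of \<open>w\<close> with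
    \<open>ket x\<close> gives the conjugate of its coordinate at \<open>x\<close>, which has to
    equal \<open>cinner w (blinfun_apply S (ket x))\<close>.\<close>
  define c where "c = (\<lambda>w x. cinner (blinfun_apply S (ket x)) w)"
  define t where "t = (\<lambda>w. Abs_ell2 (c w))"
  have bound: "L2_set (\<lambda>x. cmod (c w x)) F \<le> norm S * norm w" if "finite F" for w F
    unfolding c_def by (rule adjoint_coordinates_bound[OF S that])
  then have summable: "(\<lambda>x. (cmod (c w x))\<^sup>2) summable_on UNIV" for w
    unfolding ell2_iff_bounded by blast
  then have Rep_t: "Rep_ell2 (t w) x = c w x" for w x
    unfolding t_def by (simp add: Abs_ell2_inverse)
  have norm_t: "norm (t w) \<le> norm S * norm w" for w
  proof -
    have "(\<Sum>\<^sub>\<infinity>x. (cmod (c w x))\<^sup>2) \<le> (norm S * norm w)\<^sup>2"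
      by (rule infsum_le_finite_sums[OF summable])
        (rule sqrt_le_D, use bound in \<open>simp add: L2_set_def\<close>)
    then show ?thesis
      unfolding norm_ell2.rep_eq[of "t w"] Rep_t by (intro real_le_lsqrt) auto
  qed
  \<comment> \<open>On multiples of basis vectors this is the choice of \<open>c\<close>; additivity
    and continuity in \<open>v\<close> extend it to the whole space.\<close>
  have t: "cinner (t w) v = cinner w (blinfun_apply S v)" for v w
  proof (induction v rule: ell2_closed_induct)
    show "closed {v. cinner (t w) v = cinner w (blinfun_apply S v)}"
      by (intro closed_Collect_eq cinner.continuous_on continuous_intros)
    show "cinner (t w) (cscale k (ket a)) = cinner w (blinfun_apply S (cscale k (ket a)))" for k a
      by (simp add: bounded_operatorsD[OF S] cinner_cscale_right cinner_ket_right Rep_t c_def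
          cnj_cinner)
  qed (simp_all add: cinner.zero_right cinner_add_right blinfun.add_right blinfun.zero_right)
  \<comment> \<open>Linearity follows from the identity \<open>t\<close>, because a vector is
    determined by its pairings with all \<open>v\<close>.\<close>
  have "bounded_linear t"
  proof (rule bounded_linear_intro[where K = "norm S"])
    show "t (v + w) = t v + t w" for v w
      by (rule ell2_eqI) (simp add: t cinner_add_left)
    show "t (r *\<^sub>R v) = r *\<^sub>R t v" for r v
      by (rule ell2_eqI) (simp add: t cinner.scaleR_left)
  qed (use norm_t in \<open>simp add: mult.commute\<close>)
  then have apply_t: "blinfun_apply (Blinfun t) w = t w" for w
    by (simp add: bounded_linear_Blinfun_apply)
  show thesis
  proof
    show "norm (Blinfun t) \<le> norm S"
      by (rule norm_blinfun_bound) (simp_all add: apply_t norm_t)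
  qed (simp add: apply_t t)
qed

text \<open>Since \<open>adj\<close> is a definite description, uniqueness is required too; it comes
  from nondegeneracy of the inner product.\<close>

lemma adj_eqI:
  assumes "\<And>v w. cinner (blinfun_apply T w) v = cinner w (blinfun_apply S v)"
  shows "adj S = T"
  unfolding adj_def
proof (rule the_equality)
  show "T' = T" if "\<forall>v w. cinner (blinfun_apply T' w) v = cinner w (blinfun_apply S v)" for T'
    by (intro blinfun_eqI ell2_eqI) (simp add: that assms)
qed (simp add: assms)

lemma
  assumes "S \<in> bounded_operators"
  shows cinner_adj_left: "cinner (blinfun_apply (adj S) w) v = cinner w (blinfun_apply S v)"
    and norm_adj_le: "norm (adj S) \<le> norm S"
  using adjoint_exists[OF assms] adj_eqI by metis+

lemma cinner_adj_right:
  assumes "S \<in> bounded_operators"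
  shows "cinner v (blinfun_apply (adj S) w) = cinner (blinfun_apply S v) w"
  by (metis cinner_adj_left[OF assms] cnj_cinner)

lemma adj_bounded_operators:
  assumes "S \<in> bounded_operators"
  shows "adj S \<in> bounded_operators"
  unfolding bounded_operators_def
  by (auto intro!: ell2_eqI simp: cinner_adj_left[OF assms] cinner_cscale_left)

lemma adj_diff:
  assumes "S \<in> bounded_operators" "T \<in> bounded_operators"
  shows "adj (S - T) = adj S - adj T"
  by (rule adj_eqI)
    (simp add: blinfun.diff_left cinner.diff_left cinner.diff_right cinner_adj_left assms)

lemma tendsto_adj:
  assumes "(S \<longlongrightarrow> T) F" "\<And>k. S k \<in> bounded_operators" "T \<in> bounded_operators"
  shows "((\<lambda>k. adj (S k)) \<longlongrightarrow> adj T) F"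
proof (rule metric_tendsto_imp_tendsto[OF assms(1)])
  show "\<forall>\<^sub>F k in F. dist (adj (S k)) (adj T) \<le> dist (S k) T"
    \<comment> \<open>The contraction estimate is applied to the difference \<open>S k - T\<close>,
      which is again complex-linear.\<close>
    using norm_adj_le[OF bounded_operators_diff[OF assms(2,3)]]
    by (simp add: dist_norm adj_diff assms)
qed


section \<open>Finite propagation\<close>

lemma finite_propagation_zero: "0 \<in> finite_propagation_operators d"
proof -
  have "cscale c (0 :: 'b ell2) = 0" for c
    by transfer simp
  then show ?thesis
    unfolding finite_propagation_operators_def bounded_operators_def propagation_le_def
    by (simp add: cinner.zero_right)
qed

lemma finite_propagation_add:
  assumes "S \<in> finite_propagation_operators d" "T \<in> finite_propagation_operators d"
  shows "S + T \<in> finite_propagation_operators d"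
proof -
  obtain K L where "propagation_le d S K" "propagation_le d T L"
    using assms unfolding finite_propagation_operators_def by blast
  \<comment> \<open>If an entry of the sum is nonzero, so is the corresponding entry of
    \<open>S\<close> or of \<open>T\<close>.\<close>
  then have "propagation_le d (S + T) (max K L)"
    unfolding propagation_le_def
    by (metis add.right_neutral blinfun.add_left cinner_add_right le_max_iff_disj)
  then show ?thesis
    using assms bounded_operators_add unfolding finite_propagation_operators_def by blast
qed

lemma finite_propagation_op_cscale:
  assumes "S \<in> finite_propagation_operators d"
  shows "op_cscale c S \<in> finite_propagation_operators d"
proof -
  have "propagation_le d (op_cscale c S) L" if "propagation_le d S L" for L
    using that unfolding propagation_le_def
    by (simp add: blinfun_apply_op_cscale cinner_cscale_right)
  then show ?thesis
    using assms bounded_operators_op_cscale unfolding finite_propagation_operators_def by blast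
qed

lemma propagation_le_triple:
  assumes d: "Metric_space UNIV d"
    and ops: "m \<in> bounded_operators" "n \<in> bounded_operators"
    and L: "propagation_le d m L\<^sub>1" "propagation_le d n L\<^sub>2" "propagation_le d r L\<^sub>3"
  shows "propagation_le d (m o\<^sub>L adj n o\<^sub>L r) (L\<^sub>1 + L\<^sub>2 + L\<^sub>3)"
  unfolding propagation_le_def
proof (intro allI impI)
  fix x y
  assume "cinner (ket y) (blinfun_apply (m o\<^sub>L adj n o\<^sub>L r) (ket x)) \<noteq> 0"
  \<comment> \<open>Moving \<open>m\<close> to the left turns the entry into an inner product over
    \<open>'x\<close>, where a common nonzero coordinate can be picked.\<close>
  then have "cinner (blinfun_apply (adj m) (ket y))
      (blinfun_apply (adj n) (blinfun_apply r (ket x))) \<noteq> 0"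
    by (simp add: cinner_adj_left ops)
  then obtain x' where x': "Rep_ell2 (blinfun_apply (adj m) (ket y)) x' \<noteq> 0"
      "Rep_ell2 (blinfun_apply (adj n) (blinfun_apply r (ket x))) x' \<noteq> 0"
    by (rule cinner_nonzeroE)
  \<comment> \<open>The coordinate of \<open>adj m\<close> applied to \<open>ket y\<close> at
    \<open>x'\<close> is the conjugate of the entry of \<open>m\<close> at \<open>y\<close>,
    \<open>x'\<close>.\<close>
  have "cinner (ket y) (blinfun_apply m (ket x')) \<noteq> 0"
    using x'(1) by (metis cinner_adj_left cinner_ket_right complex_cnj_zero_iff ops(1))
  then have m: "d (Inl x') (Inr y) \<le> L\<^sub>1"
    using L(1) unfolding propagation_le_def by blast
  \<comment> \<open>Moving \<open>n\<close> across in the same way gives an inner product over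
    \<open>'y\<close>, which yields the second intermediate point.\<close>
  have "cinner (blinfun_apply n (ket x')) (blinfun_apply r (ket x)) \<noteq> 0"
    using x'(2) by (metis cinner_adj_right cinner_ket_left ops(2))
  then obtain y' where "Rep_ell2 (blinfun_apply n (ket x')) y' \<noteq> 0"
      "Rep_ell2 (blinfun_apply r (ket x)) y' \<noteq> 0"
    by (rule cinner_nonzeroE)
  then have nr: "d (Inl x') (Inr y') \<le> L\<^sub>2" "d (Inl x) (Inr y') \<le> L\<^sub>3"
    using L(2,3) unfolding propagation_le_def cinner_ket_left by blast+
  have "d (Inl x) (Inr y) \<le> d (Inl x) (Inr y') + d (Inr y') (Inl x') + d (Inl x') (Inr y)"
    using Metric_space.triangle[OF d, of "Inl x" "Inr y'" "Inr y"]
      Metric_space.triangle[OF d, of "Inr y'" "Inl x'" "Inr y"] by simp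
  also have "\<dots> \<le> L\<^sub>1 + L\<^sub>2 + L\<^sub>3"
    using m nr Metric_space.commute[OF d, of "Inr y'" "Inl x'"] by simp
  finally show "d (Inl x) (Inr y) \<le> L\<^sub>1 + L\<^sub>2 + L\<^sub>3" .
qed

lemma finite_propagation_triple:
  assumes "Metric_space UNIV d"
    and "m \<in> finite_propagation_operators d" "n \<in> finite_propagation_operators d"
      "r \<in> finite_propagation_operators d"
  shows "m o\<^sub>L adj n o\<^sub>L r \<in> finite_propagation_operators d"
  using assms propagation_le_triple[OF assms(1)]
  unfolding finite_propagation_operators_def
  by (blast intro: bounded_operators_compose adj_bounded_operators)

section \<open>Passage to the norm closure\<close>

lemma roe_module_subset_bounded_operators: "roe_module d \<subseteq> bounded_operators"
  unfolding roe_module_def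
  by (intro closure_minimal closed_bounded_operators) (auto simp: finite_propagation_operators_def)

lemma closed_complex_subspace_roe_module: "closed_complex_subspace (roe_module d)"
  unfolding closed_complex_subspace_def
proof (intro conjI ballI allI)
  show "closed (roe_module d)"
    unfolding roe_module_def by simp
  show "0 \<in> roe_module d"
    unfolding roe_module_def using closure_subset finite_propagation_zero by blast
next
  fix S T assume "S \<in> roe_module d" "T \<in> roe_module d"
  then obtain s t where "\<And>k. s k \<in> finite_propagation_operators d" "s \<longlonglongrightarrow> S"
      "\<And>k. t k \<in> finite_propagation_operators d" "t \<longlonglongrightarrow> T"
    unfolding roe_module_def closure_sequential by blast
  then show "S + T \<in> roe_module d"
    unfolding roe_module_def closure_sequential
    by (intro exI[of _ "\<lambda>k. s k + t k"]) (simp add: finite_propagation_add tendsto_add)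
next
  fix c S assume "S \<in> roe_module d"
  then obtain s where "\<And>k. s k \<in> finite_propagation_operators d" "s \<longlonglongrightarrow> S"
    unfolding roe_module_def closure_sequential by blast
  then show "op_cscale c S \<in> roe_module d"
    unfolding roe_module_def closure_sequential
    by (intro exI[of _ "\<lambda>k. op_cscale c (s k)"])
      (simp add: finite_propagation_op_cscale bounded_linear.tendsto[OF bounded_linear_op_cscale])
qed

lemma roe_module_triple:
  assumes d: "Metric_space UNIV d"
    and M: "m \<in> roe_module d" "n \<in> roe_module d" "r \<in> roe_module d"
  shows "m o\<^sub>L adj n o\<^sub>L r \<in> roe_module d"
proof -
  obtain m' n' r' where fin: "\<And>k. m' k \<in> finite_propagation_operators d"
      "\<And>k. n' k \<in> finite_propagation_operators d" "\<And>k. r' k \<in> finite_propagation_operators d"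
    and lim: "m' \<longlonglongrightarrow> m" "n' \<longlonglongrightarrow> n" "r' \<longlonglongrightarrow> r"
    using M unfolding roe_module_def closure_sequential by metis
  \<comment> \<open>Continuity of \<open>adj\<close> is available along complex-linear operators
    with a complex-linear limit; the limit \<open>n\<close> qualifies because that set is
    closed.\<close>
  have "n' k \<in> bounded_operators" for k
    using fin(2)[of k] unfolding finite_propagation_operators_def by simp
  then have "(\<lambda>k. adj (n' k)) \<longlonglongrightarrow> adj n"
    using tendsto_adj[OF lim(2)] M(2) roe_module_subset_bounded_operators by blast
  \<comment> \<open>Composition is jointly continuous in the operator norm; this is applied to both
    products.\<close>
  then have "(\<lambda>k. m' k o\<^sub>L adj (n' k) o\<^sub>L r' k) \<longlonglongrightarrow> (m o\<^sub>L adj n o\<^sub>L r)"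
    by (intro bounded_bilinear.tendsto[OF bounded_bilinear_blinfun_compose] lim)
  then show ?thesis
    unfolding roe_module_def closure_sequential
    by (intro exI[of _ "\<lambda>k. m' k o\<^sub>L adj (n' k) o\<^sub>L r' k"])
      (simp add: finite_propagation_triple d fin)
qed

theorem lemma4p1:
  fixes d :: "'x::metric_space + 'y::metric_space \<Rightarrow> 'x + 'y \<Rightarrow> real"
  assumes "uniform_discrete (UNIV :: 'x set)" and "bounded_geometry (UNIV :: 'x set)"
    and "uniform_discrete (UNIV :: 'y set)" and "bounded_geometry (UNIV :: 'y set)"
    and "d \<in> compatible_metrics"
  shows "ternary_ring_of_operators (roe_module d)"
proof -
  have "Metric_space UNIV d"
    using assms(5) unfolding compatible_metrics_def by simp
  then show ?thesis
    unfolding ternary_ring_of_operators_def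
    using roe_module_subset_bounded_operators closed_complex_subspace_roe_module
      roe_module_triple by blast
qed

end
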